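(* Let $\mu$ be a finite positive measure on $\mathbb{C}$. If the Cauchy transform is bounded in $L^2(\mu)$, then it is injective (has a trivial kernel): if $f\in L^2(\mu)$ and $C^{f d\mu}=0$ at $\mu$-a.e. point, then $f=0$ $\mu$-a.e.
   Context: For a finite complex measure $\nu$ on $\mathbb{C}$, $\varepsilon>0$ and $z\in\mathbb{C}$, put $C^{\nu}_{\varepsilon}(z)=\int_{|\zeta-z|>\varepsilon}\frac{d\nu(\zeta)}{\zeta-z}$ and $C^{\nu}(z)=\lim_{\varepsilon\to 0}C^{\nu}_{\varepsilon}(z)$ if the limit exists. The Cauchy transform is said to be bounded in $L^2(\mu)$ if the functions $C^{f d\mu}_{\varepsilon}$, $\varepsilon>0$, are uniformly bounded in $L^2(\mu)$-norm for any $f\in L^2(\mu)$. In this case (a result of Tolsa) the functions $C^{f d\mu}_{\varepsilon}$ converge $\mu$-a.e. as $\varepsilon\to0$, and the image $C^{f d\mu}$ exists as a function in $L^2(\mu)$.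
   Formalization: The finite positive measure μ is additionally assumed to have no atoms (every point has measure zero); without this the claim fails, e.g. for a unit point mass at 0 with f = 1, where all truncated transforms vanish μ-a.e. *)

theory Defs
  imports "HOL-Analysis.Analysis"
begin

definition L2_fun :: "complex measure \<Rightarrow> (complex \<Rightarrow> complex) \<Rightarrow> bool" where
  "L2_fun \<mu> f \<longleftrightarrow> f \<in> borel_measurable \<mu> \<and> integrable \<mu> (\<lambda>z. (cmod (f z))\<^sup>2)"

definition L2_fun_norm :: "complex measure \<Rightarrow> (complex \<Rightarrow> complex) \<Rightarrow> real" where
  "L2_fun_norm \<mu> f = sqrt (\<integral>z. (cmod (f z))\<^sup>2 \<partial>\<mu>)"

(* The truncated Cauchy transform of the complex measure f d\<mu>, which is given by its
   density f with respect to \<mu>. It is meant for f integrable over \<mu>; this holds for every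
   f in L^2(\<mu>) if \<mu> is finite. Pitfall: the truncation removes \<zeta> = z, so an atom of \<mu>
   at z contributes nothing to the value at z. For a point mass every truncated transform
   vanishes \<mu>-a.e.: the transform is bounded in L^2(\<mu>) but not injective. *)
definition cauchy_trunc ::
    "complex measure \<Rightarrow> (complex \<Rightarrow> complex) \<Rightarrow> real \<Rightarrow> complex \<Rightarrow> complex" where
  "cauchy_trunc \<mu> f \<epsilon> z = (LINT \<zeta>:{\<zeta>. cmod (\<zeta> - z) > \<epsilon>}|\<mu>. f \<zeta> / (\<zeta> - z))"

(* The principal value at z exists and equals w. A relation rather than a function, so that
   no value is assigned where the limit does not exist. *)
definition has_cauchy_transform ::
    "complex measure \<Rightarrow> (complex \<Rightarrow> complex) \<Rightarrow> complex \<Rightarrow> complex \<Rightarrow> bool" where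
  "has_cauchy_transform \<mu> f z w \<longleftrightarrow> ((\<lambda>\<epsilon>. cauchy_trunc \<mu> f \<epsilon> z) \<longlongrightarrow> w) (at_right 0)"

(* The bound M may depend on f, but not on \<epsilon>. *)
definition cauchy_L2_bounded :: "complex measure \<Rightarrow> bool" where
  "cauchy_L2_bounded \<mu> \<longleftrightarrow>
     (\<forall>f. L2_fun \<mu> f \<longrightarrow>
        (\<exists>M. \<forall>\<epsilon>>0. L2_fun \<mu> (cauchy_trunc \<mu> f \<epsilon>) \<and> L2_fun_norm \<mu> (cauchy_trunc \<mu> f \<epsilon>) \<le> M))"

end

theory Submission
  imports Defs "HOL-Complex_Analysis.Winding_Numbers"
begin

text \<open>
  Write \<open>F z = \<integral> f \<zeta> / (\<zeta> - z) d\<mu>\<close>, which converges absolutely at area-a.e. point. Since \<open>\<mu>\<close> has no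
  atoms, symmetrising the double integral for \<open>F z\<^sup>2\<close> over \<open>|a - b| > \<epsilon>\<close> gives
  \<open>F z\<^sup>2 = lim 2 \<integral> f C\<^sub>\<epsilon> / (a - z) d\<mu>\<close>, where \<open>C\<^sub>\<epsilon>\<close> is the truncated transform of \<open>f d\<mu>\<close>. As \<open>C\<^sub>\<epsilon>\<close> is
  bounded in \<open>L\<^sup>2(\<mu>)\<close> and tends to 0 a.e., \<open>f C\<^sub>\<epsilon>\<close> tends to 0 in \<open>L\<^sup>1(\<mu>)\<close>. The kernel \<open>1 / |a - z|\<close> has bounded
  area integrals over compact sets, so Fatou's lemma yields \<open>F = 0\<close> area-a.e. Then \<open>F\<close> vanishes
  a.e. on almost every horizontal and vertical line, and integrating it around rectangles with
  sides on such lines shows that \<open>f d\<mu>\<close> has no mass on boxes.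
\<close>

section \<open>Products of square-integrable functions that tend to zero in mean\<close>

text \<open>Young's inequality splits the product into at most
  \<open>\<delta> * (cmod (g n x))\<^sup>2\<close>, whose integral is at most
  \<open>\<delta> * B\<close>, and an excess dominated by a fixed multiple of
  \<open>(cmod (f x))\<^sup>2\<close>. Dominated convergence applies to the excess, so a norm bound
  together with a.e. convergence suffices.\<close>

lemma nn_integral_norm_mult_tendsto_0:
  fixes f :: "'a \<Rightarrow> complex" and g :: "nat \<Rightarrow> 'a \<Rightarrow> complex"
  assumes [measurable]: "f \<in> borel_measurable M" "\<And>n. g n \<in> borel_measurable M"
    and f: "integrable M (\<lambda>x. (cmod (f x))\<^sup>2)"
    and g: "\<And>n. integrable M (\<lambda>x. (cmod (g n x))\<^sup>2)"
    and B: "\<And>n. (\<integral>x. (cmod (g n x))\<^sup>2 \<partial>M) \<le> B"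
    and lim: "AE x in M. (\<lambda>n. g n x) \<longlonglongrightarrow> 0"
  shows "(\<lambda>n. \<integral>\<^sup>+x. ennreal (cmod (f x) * cmod (g n x)) \<partial>M) \<longlonglongrightarrow> 0"
proof -
  have prod_le: "cmod (f x) * cmod (g n x) \<le> \<delta> * (cmod (g n x))\<^sup>2 + (cmod (f x))\<^sup>2 / (4 * \<delta>)"
    if "\<delta> > 0" for \<delta> x n
  proof -
    have "0 \<le> (2 * \<delta> * cmod (g n x) - cmod (f x))\<^sup>2 / (4 * \<delta>)"
      using that by simp
    then show ?thesis using that by (simp add: power2_eq_square field_simps)
  qed
  have fg: "integrable M (\<lambda>x. cmod (f x) * cmod (g n x))" for n
  proof (rule Bochner_Integration.integrable_bound)
    show "integrable M (\<lambda>x. 1 * (cmod (g n x))\<^sup>2 + (cmod (f x))\<^sup>2 / (4 * 1))"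
      using f g by simp
  qed (use prod_le[of 1] in \<open>auto intro!: AE_I2 order_trans[OF _ abs_ge_self]\<close>)
  have "(\<lambda>n. \<integral>x. cmod (f x) * cmod (g n x) \<partial>M) \<longlonglongrightarrow> 0"
  proof (rule LIMSEQ_I)
    fix e :: real assume e: "e > 0"
    have B0: "B \<ge> 0"
      using B[of 0] by (rule order_trans[rotated]) simp
    \<comment> \<open>Makes the \<open>\<delta> * B\<close> share less than \<open>e / 2\<close>;
      the \<open>+ 1\<close> keeps the denominator positive when \<open>B = 0\<close>.\<close>
    define \<delta> where "\<delta> = e / (2 * (B + 1))"
    have \<delta>: "\<delta> > 0" "\<delta> * B < e / 2"
      using e B0 by (auto simp: \<delta>_def field_simps)
    define h where "h n x = max 0 (cmod (f x) * cmod (g n x) - \<delta> * (cmod (g n x))\<^sup>2)" for n x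
    have [measurable]: "h n \<in> borel_measurable M" for n
      unfolding h_def by measurable
    have h_le: "norm (h n x) \<le> (cmod (f x))\<^sup>2 / (4 * \<delta>)" for n x
      using prod_le[OF \<delta>(1), of x n] \<delta>(1) by (auto simp: h_def)
    have h_lim: "AE x in M. (\<lambda>n. h n x) \<longlonglongrightarrow> 0"
    proof (use lim in eventually_elim)
      fix x assume "(\<lambda>n. g n x) \<longlonglongrightarrow> 0"
      then have "(\<lambda>n. h n x) \<longlonglongrightarrow> max 0 (cmod (f x) * cmod 0 - \<delta> * (cmod 0)\<^sup>2)"
        unfolding h_def by (intro tendsto_intros)
      then show "(\<lambda>n. h n x) \<longlonglongrightarrow> 0" by simp
    qed
    have "(\<lambda>n. \<integral>x. h n x \<partial>M) \<longlonglongrightarrow> (\<integral>x. 0 \<partial>M)"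
      by (rule integral_dominated_convergence[where w="\<lambda>x. (cmod (f x))\<^sup>2 / (4 * \<delta>)"])
         (use f h_le h_lim in auto)
    then obtain N where N: "\<And>n. n \<ge> N \<Longrightarrow> \<bar>\<integral>x. h n x \<partial>M\<bar> < e / 2"
      using LIMSEQ_D[of _ _ "e/2"] e by fastforce
    have hint: "integrable M (h n)" for n
      by (rule Bochner_Integration.integrable_bound[where f="\<lambda>x. (cmod (f x))\<^sup>2 / (4 * \<delta>)"])
         (use f h_le \<delta>(1) in auto)
    have "norm ((\<integral>x. cmod (f x) * cmod (g n x) \<partial>M) - 0) < e" if "n \<ge> N" for n
    proof -
      have "(\<integral>x. cmod (f x) * cmod (g n x) \<partial>M) \<le> (\<integral>x. h n x + \<delta> * (cmod (g n x))\<^sup>2 \<partial>M)"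
        by (rule integral_mono) (use fg hint g in \<open>auto simp: h_def\<close>)
      also have "\<dots> = (\<integral>x. h n x \<partial>M) + \<delta> * (\<integral>x. (cmod (g n x))\<^sup>2 \<partial>M)"
        using hint g by simp
      also have "\<dots> \<le> \<bar>\<integral>x. h n x \<partial>M\<bar> + \<delta> * B"
        using B[of n] \<delta>(1) by (intro add_mono mult_left_mono) auto
      also have "\<dots> < e"
        using N[OF that] \<delta>(2) by linarith
      finally show ?thesis by simp
    qed
    then show "\<exists>N. \<forall>n\<ge>N. norm ((\<integral>x. cmod (f x) * cmod (g n x) \<partial>M) - 0) < e" by blast
  qed
  then have "(\<lambda>n. ennreal (\<integral>x. cmod (f x) * cmod (g n x) \<partial>M)) \<longlonglongrightarrow> ennreal 0"
    by (rule tendsto_ennrealI)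
  moreover have "(\<integral>\<^sup>+x. ennreal (cmod (f x) * cmod (g n x)) \<partial>M) = ennreal (\<integral>x. cmod (f x) * cmod (g n x) \<partial>M)" for n
    by (rule nn_integral_eq_integral[OF fg]) simp
  ultimately show ?thesis by simp
qed

section \<open>Product integrals and symmetrisation of the Cauchy kernel\<close>

lemma integrable_pair_mult:
  fixes f :: "'a \<Rightarrow> complex" and g :: "'b \<Rightarrow> complex"
  assumes "sigma_finite_measure M" "sigma_finite_measure N"
    and f: "integrable M f" and g: "integrable N g"
  shows "integrable (M \<Otimes>\<^sub>M N) (\<lambda>(x, y). f x * g y)"
proof -
  interpret pair_sigma_finite M N
    using assms(1,2) by (simp add: pair_sigma_finite_def)
  have [measurable]: "f \<in> borel_measurable M" "g \<in> borel_measurable N" using f g by auto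
  show ?thesis
    by (rule Fubini_integrable) (use f g in \<open>auto simp: norm_mult\<close>)
qed

lemma AE_neq_of_no_atoms:
  assumes "finite_measure \<mu>" "sets \<mu> = sets borel" and "measure \<mu> {z::'a::t1_space} = 0"
  shows "AE a in \<mu>. a \<noteq> z"
proof (rule AE_I)
  show "emeasure \<mu> {z} = 0"
    using assms finite_measure.emeasure_eq_measure[OF assms(1)] by simp
qed (use assms in auto)

lemma cauchy_trunc_measurable:
  assumes "finite_measure \<mu>" "sets \<mu> = sets borel" and [measurable]: "f \<in> borel_measurable \<mu>"
  shows "cauchy_trunc \<mu> f \<epsilon> \<in> borel_measurable \<mu>"
proof -
  interpret finite_measure \<mu> by fact
  note assms(2)[measurable_cong]
  show ?thesis
    unfolding cauchy_trunc_def set_lebesgue_integral_def indicator_def by measurable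
qed

text \<open>Integrating the partial fraction expansion
  \<open>1 / ((a - z) (b - z)) = (1 / (a - z) - 1 / (b - z)) / (b - a)\<close> off the diagonal;
  the two terms are exchanged by swapping \<open>a\<close> and \<open>b\<close>.\<close>

lemma cauchy_kernel_off_diagonal:
  fixes \<mu> :: "complex measure"
  assumes fin: "finite_measure \<mu>" and sets: "sets \<mu> = sets borel"
    and no_atoms: "measure \<mu> {z} = 0"
    and f: "integrable \<mu> f" and h: "integrable \<mu> (\<lambda>a. f a / (a - z))" and \<epsilon>: "\<epsilon> > 0"
  shows "(\<integral>(a, b). indicator {(a, b). cmod (b - a) > \<epsilon>} (a, b) *\<^sub>R (f a / (a - z) * (f b / (b - z))) \<partial>(\<mu> \<Otimes>\<^sub>M \<mu>)) =
         2 * (\<integral>a. f a / (a - z) * cauchy_trunc \<mu> f \<epsilon> a \<partial>\<mu>)"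
proof -
  interpret finite_measure \<mu> by fact
  have \<sigma>_finite: "sigma_finite_measure \<mu>" ..
  interpret pair_sigma_finite \<mu> \<mu> ..
  note sets[measurable_cong]
  have [measurable]: "f \<in> borel_measurable \<mu>" using f by auto
  \<comment> \<open>One of the two partial fraction terms. The truncation bounds
    \<open>1 / (b - a)\<close> by \<open>1 / \<epsilon>\<close>, so a product of two integrable
    functions dominates it and Fubini's theorem is available.\<close>
  define k where "k = (\<lambda>(a, b). indicator {(a, b). cmod (b - a) > \<epsilon>} (a, b) *\<^sub>R (f a / (a - z) * (f b / (b - a))))"
  have [measurable]: "k \<in> borel_measurable (\<mu> \<Otimes>\<^sub>M \<mu>)"
    unfolding k_def indicator_def by measurable
  have k_bound: "cmod (k (a, b)) \<le> cmod (f a / (a - z) * (f b / of_real \<epsilon>))" for a b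
  proof (cases "cmod (b - a) > \<epsilon>")
    case True
    then have "cmod (f b) / cmod (b - a) \<le> cmod (f b) / \<epsilon>"
      using \<epsilon> by (intro divide_left_mono mult_pos_pos) auto
    then have "cmod (f a / (a - z)) * (cmod (f b) / cmod (b - a)) \<le> cmod (f a / (a - z)) * (cmod (f b) / \<epsilon>)"
      by (intro mult_left_mono) auto
    with True \<epsilon> show ?thesis
      by (simp add: k_def norm_mult norm_divide)
  qed (auto simp: k_def)
  have k: "integrable (\<mu> \<Otimes>\<^sub>M \<mu>) k"
  proof (rule Bochner_Integration.integrable_bound)
    show "integrable (\<mu> \<Otimes>\<^sub>M \<mu>) (\<lambda>(a, b). f a / (a - z) * (f b / of_real \<epsilon>))"
      by (rule integrable_pair_mult) (use f h in \<open>auto intro: \<sigma>_finite\<close>)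
  qed (use k_bound in auto)
  \<comment> \<open>With division by zero equal to 0, the partial fraction identity can fail when
    \<open>a\<close> or \<open>b\<close> equals \<open>z\<close>; such pairs are null because
    \<open>z\<close> is not an atom.\<close>
  have "AE p in \<mu> \<Otimes>\<^sub>M \<mu>. fst p \<noteq> z \<and> snd p \<noteq> z"
  proof (rule AE_pair_measure)
    have nz: "AE a in \<mu>. a \<noteq> z" by (rule AE_neq_of_no_atoms) fact+
    show "AE x in \<mu>. AE y in \<mu>. fst (x, y) \<noteq> z \<and> snd (x, y) \<noteq> z"
      using nz by (auto elim!: eventually_mono)
  qed measurable
  then have "AE p in \<mu> \<Otimes>\<^sub>M \<mu>. (case p of (a, b) \<Rightarrow> indicator {(a, b). cmod (b - a) > \<epsilon>} (a, b) *\<^sub>R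
      (f a / (a - z) * (f b / (b - z)))) = k p + k (case p of (a, b) \<Rightarrow> (b, a))"
  proof eventually_elim
    case (elim p)
    obtain a b where p: "p = (a, b)" by (cases p)
    show ?case
    proof (cases "cmod (b - a) > \<epsilon>")
      case True
      then have nz: "b - a \<noteq> 0" "a - b \<noteq> 0" "a - z \<noteq> 0" "b - z \<noteq> 0"
        using \<epsilon> elim by (auto simp: p)
      have "f a / (a - z) * (f b / (b - z)) =
          f a / (a - z) * (f b / (b - a)) + f b / (b - z) * (f a / (a - b))"
        using nz by (simp add: divide_simps) (simp add: algebra_simps)
      then show ?thesis using True by (simp add: p k_def norm_minus_commute)
    qed (auto simp: p k_def norm_minus_commute)
  qed
  then have "(\<integral>(a, b). indicator {(a, b). cmod (b - a) > \<epsilon>} (a, b) *\<^sub>R (f a / (a - z) * (f b / (b - z))) \<partial>(\<mu> \<Otimes>\<^sub>M \<mu>)) =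
     (\<integral>p. k p + k (case p of (a, b) \<Rightarrow> (b, a)) \<partial>(\<mu> \<Otimes>\<^sub>M \<mu>))"
    by (intro integral_cong_AE) (simp_all add: indicator_def)
  also have "\<dots> = (\<integral>p. k p \<partial>(\<mu> \<Otimes>\<^sub>M \<mu>)) + (\<integral>p. k (case p of (a, b) \<Rightarrow> (b, a)) \<partial>(\<mu> \<Otimes>\<^sub>M \<mu>))"
    using k integrable_product_swap[OF k] by (simp add: case_prod_beta')
  also have "(\<integral>p. k (case p of (a, b) \<Rightarrow> (b, a)) \<partial>(\<mu> \<Otimes>\<^sub>M \<mu>)) = (\<integral>p. k p \<partial>(\<mu> \<Otimes>\<^sub>M \<mu>))"
    using integral_product_swap[of k] by (simp add: case_prod_beta')
  also have "(\<integral>p. k p \<partial>(\<mu> \<Otimes>\<^sub>M \<mu>)) = (\<integral>a. \<integral>b. k (a, b) \<partial>\<mu> \<partial>\<mu>)"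
    using integral_fst'[OF k] by simp
  also have "\<dots> = (\<integral>a. f a / (a - z) * cauchy_trunc \<mu> f \<epsilon> a \<partial>\<mu>)"
  proof (rule Bochner_Integration.integral_cong)
    fix a
    have "(\<integral>b. k (a, b) \<partial>\<mu>) = (\<integral>b. f a / (a - z) * (indicator {b. cmod (b - a) > \<epsilon>} b *\<^sub>R (f b / (b - a))) \<partial>\<mu>)"
      by (intro Bochner_Integration.integral_cong) (auto simp: k_def indicator_def)
    also have "\<dots> = f a / (a - z) * cauchy_trunc \<mu> f \<epsilon> a"
      by (simp only: integral_mult_right_zero cauchy_trunc_def set_lebesgue_integral_def)
    finally show "(\<integral>b. k (a, b) \<partial>\<mu>) = f a / (a - z) * cauchy_trunc \<mu> f \<epsilon> a" .
  qed simp
  finally show ?thesis by simp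
qed

text \<open>By symmetrisation the left side is the double integral over pairs more than
  \<open>\<epsilon> n\<close> apart. Without atoms the diagonal is null for the product measure, so
  dominated convergence restores the full double integral, which factors into a square.\<close>

lemma cauchy_trunc_pairing_tendsto:
  fixes \<mu> :: "complex measure"
  assumes fin: "finite_measure \<mu>" and sets: "sets \<mu> = sets borel"
    and no_atoms: "\<And>z. measure \<mu> {z} = 0"
    and f: "integrable \<mu> f" and h: "integrable \<mu> (\<lambda>a. f a / (a - z))"
    and \<epsilon>: "\<And>n. \<epsilon> n > 0" "\<epsilon> \<longlonglongrightarrow> 0"
  shows "(\<lambda>n. 2 * (\<integral>a. f a / (a - z) * cauchy_trunc \<mu> f (\<epsilon> n) a \<partial>\<mu>)) \<longlonglongrightarrow> (\<integral>a. f a / (a - z) \<partial>\<mu>)\<^sup>2"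
proof -
  interpret finite_measure \<mu> by fact
  have \<sigma>_finite: "sigma_finite_measure \<mu>" ..
  interpret pair_sigma_finite \<mu> \<mu> ..
  note sets[measurable_cong]
  have [measurable]: "f \<in> borel_measurable \<mu>" using f by auto
  let ?h = "\<lambda>a. f a / (a - z)"
  let ?H = "\<lambda>(a, b). ?h a * ?h b"
  let ?G = "\<lambda>n (a, b). indicator {(a, b). cmod (b - a) > \<epsilon> n} (a, b) *\<^sub>R (?h a * ?h b)"
  have H: "integrable (\<mu> \<Otimes>\<^sub>M \<mu>) ?H"
    by (rule integrable_pair_mult) (use h in \<open>auto intro: \<sigma>_finite\<close>)
  have "AE p in \<mu> \<Otimes>\<^sub>M \<mu>. fst p \<noteq> snd p"
  proof (rule AE_pair_measure)
    show "AE x in \<mu>. AE y in \<mu>. fst (x, y) \<noteq> snd (x, y)"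
    proof (rule AE_I2)
      fix x show "AE y in \<mu>. fst (x, y) \<noteq> snd (x, y)"
        using AE_neq_of_no_atoms[OF fin sets no_atoms, of x] by eventually_elim auto
    qed
  qed measurable
  then have lim: "AE p in \<mu> \<Otimes>\<^sub>M \<mu>. (\<lambda>n. ?G n p) \<longlonglongrightarrow> ?H p"
  proof eventually_elim
    case (elim p)
    obtain a b where p: "p = (a, b)" by (cases p)
    have "\<forall>\<^sub>F n in sequentially. \<epsilon> n < cmod (b - a)"
      using elim by (intro order_tendstoD(2)[OF \<epsilon>(2)]) (auto simp: p)
    then have "\<forall>\<^sub>F n in sequentially. ?G n p = ?H p"
      by eventually_elim (auto simp: p)
    then show ?case by (rule tendsto_eventually)
  qed
  have "(\<lambda>n. \<integral>p. ?G n p \<partial>(\<mu> \<Otimes>\<^sub>M \<mu>)) \<longlonglongrightarrow> (\<integral>p. ?H p \<partial>(\<mu> \<Otimes>\<^sub>M \<mu>))"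
  proof (rule integral_dominated_convergence[where w="\<lambda>p. norm (?H p)"])
    show "?G n \<in> borel_measurable (\<mu> \<Otimes>\<^sub>M \<mu>)" for n
      unfolding indicator_def by measurable
    show "AE p in \<mu> \<Otimes>\<^sub>M \<mu>. norm (?G n p) \<le> norm (?H p)" for n
      by (auto simp: indicator_def)
  qed (use H lim in auto)
  also have "(\<integral>p. ?H p \<partial>(\<mu> \<Otimes>\<^sub>M \<mu>)) = (\<integral>a. f a / (a - z) \<partial>\<mu>)\<^sup>2"
    unfolding integral_fst'[OF H, symmetric]
    by (simp only: prod.case integral_mult_right_zero integral_mult_left_zero power2_eq_square)
  finally show ?thesis
    by (simp only: cauchy_kernel_off_diagonal[OF fin sets no_atoms f h \<epsilon>(1)])
qed

section \<open>Potentials and the vanishing of the Cauchy integral almost everywhere\<close>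

text \<open>Tonelli's theorem brings the kernel under the integral over \<open>N\<close>, where
  \<open>K\<close> bounds it uniformly in the pole. The pair \<open>N\<close>, \<open>p\<close>
  stands for area on a bounded region in some choice of coordinates.\<close>

lemma nn_integral_potential_le:
  fixes p :: "'b \<Rightarrow> complex" and w :: "complex \<Rightarrow> real"
  assumes "finite_measure \<mu>" and sets: "sets \<mu> = sets borel" and "sigma_finite_measure N"
    and [measurable]: "p \<in> borel_measurable N" "w \<in> borel_measurable \<mu>"
    and w: "\<And>\<zeta>. 0 \<le> w \<zeta>"
    and K: "\<And>\<zeta>. (\<integral>\<^sup>+s. ennreal (1 / cmod (\<zeta> - p s)) \<partial>N) \<le> K"
  shows "(\<integral>\<^sup>+s. \<integral>\<^sup>+\<zeta>. ennreal (w \<zeta> / cmod (\<zeta> - p s)) \<partial>\<mu> \<partial>N) \<le> K * (\<integral>\<^sup>+\<zeta>. ennreal (w \<zeta>) \<partial>\<mu>)"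
proof -
  interpret M: finite_measure \<mu> by fact
  interpret N: sigma_finite_measure N by fact
  interpret pair_sigma_finite \<mu> N ..
  note sets[measurable_cong]
  have "(\<integral>\<^sup>+s. \<integral>\<^sup>+\<zeta>. ennreal (w \<zeta> / cmod (\<zeta> - p s)) \<partial>\<mu> \<partial>N)
      = (\<integral>\<^sup>+\<zeta>. \<integral>\<^sup>+s. ennreal (w \<zeta> / cmod (\<zeta> - p s)) \<partial>N \<partial>\<mu>)"
    by (rule Fubini') measurable
  also have "\<dots> = (\<integral>\<^sup>+\<zeta>. ennreal (w \<zeta>) * (\<integral>\<^sup>+s. ennreal (1 / cmod (\<zeta> - p s)) \<partial>N) \<partial>\<mu>)"
    by (intro nn_integral_cong, subst nn_integral_cmult[symmetric])
       (auto simp: w ennreal_mult[symmetric])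
  also have "\<dots> \<le> (\<integral>\<^sup>+\<zeta>. ennreal (w \<zeta>) * K \<partial>\<mu>)"
    by (intro nn_integral_mono mult_left_mono K) auto
  also have "\<dots> = K * (\<integral>\<^sup>+\<zeta>. ennreal (w \<zeta>) \<partial>\<mu>)"
    by (subst nn_integral_multc) (auto simp: mult.commute)
  finally show ?thesis .
qed

lemma L2_fun_integrable:
  assumes "finite_measure \<mu>" "L2_fun \<mu> f"
  shows "integrable \<mu> f"
proof -
  interpret finite_measure \<mu> by fact
  have "t \<le> 1 + t\<^sup>2" for t :: real
    using zero_le_power2[of "t - 1/2"] by (simp add: power2_eq_square algebra_simps)
  then show ?thesis
    using assms(2) unfolding L2_fun_def
    by (intro Bochner_Integration.integrable_bound[where g=f and f="\<lambda>z. 1 + (cmod (f z))\<^sup>2"])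
       (auto intro!: AE_I2 order_trans[OF _ abs_ge_self])
qed

text \<open>The potential bound with the modulus of \<open>f\<close> as weight. It makes the Cauchy
  integral of \<open>f\<close> absolutely convergent at \<open>p s\<close> for \<open>N\<close>-a.e.
  \<open>s\<close>.\<close>

lemma nn_integral_potential_finite:
  fixes p :: "'b \<Rightarrow> complex"
  assumes "finite_measure \<mu>" "sets \<mu> = sets borel" "sigma_finite_measure N"
    and "p \<in> borel_measurable N" and f: "integrable \<mu> f"
    and K: "\<And>\<zeta>. (\<integral>\<^sup>+s. ennreal (1 / cmod (\<zeta> - p s)) \<partial>N) \<le> K" "K < \<infinity>"
  shows "(\<integral>\<^sup>+s. \<integral>\<^sup>+\<zeta>. ennreal (cmod (f \<zeta> / (\<zeta> - p s))) \<partial>\<mu> \<partial>N) < \<infinity>"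
proof -
  have "(\<integral>\<^sup>+\<zeta>. ennreal (cmod (f \<zeta>)) \<partial>\<mu>) < \<infinity>"
    using f by (simp add: integrable_iff_bounded)
  then have "K * (\<integral>\<^sup>+\<zeta>. ennreal (cmod (f \<zeta>)) \<partial>\<mu>) < \<infinity>"
    using K(2) by (simp add: ennreal_mult_less_top)
  moreover have "(\<integral>\<^sup>+s. \<integral>\<^sup>+\<zeta>. ennreal (cmod (f \<zeta>) / cmod (\<zeta> - p s)) \<partial>\<mu> \<partial>N) \<le> K * (\<integral>\<^sup>+\<zeta>. ennreal (cmod (f \<zeta>)) \<partial>\<mu>)"
    using assms by (intro nn_integral_potential_le) auto
  ultimately show ?thesis by (simp add: norm_divide)
qed

proposition cauchy_integral_eq_0_AE:
  fixes p :: "'b \<Rightarrow> complex"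
  assumes fin: "finite_measure \<mu>" and sets: "sets \<mu> = sets borel"
    and no_atoms: "\<And>z. measure \<mu> {z} = 0"
    and bdd: "cauchy_L2_bounded \<mu>" and L2: "L2_fun \<mu> f"
    and van: "AE z in \<mu>. has_cauchy_transform \<mu> f z 0"
    and N: "sigma_finite_measure N" and p[measurable]: "p \<in> borel_measurable N"
    and K: "\<And>\<zeta>. (\<integral>\<^sup>+s. ennreal (1 / cmod (\<zeta> - p s)) \<partial>N) \<le> K" "K < \<infinity>"
  shows "AE s in N. (\<integral>\<zeta>. f \<zeta> / (\<zeta> - p s) \<partial>\<mu>) = 0"
proof -
  interpret finite_measure \<mu> by fact
  interpret N: sigma_finite_measure N by fact
  interpret pair_sigma_finite \<mu> N ..
  note sets[measurable_cong]
  have f: "integrable \<mu> f" by (rule L2_fun_integrable) fact+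
  then have [measurable]: "f \<in> borel_measurable \<mu>" by auto
  \<comment> \<open>Dominated convergence and Fatou's lemma work along sequences, so the limit from
    the right at 0 is sampled at these radii.\<close>
  define \<epsilon> where "\<epsilon> n = inverse (real (Suc n))" for n
  have \<epsilon>: "\<epsilon> n > 0" "\<epsilon> \<longlonglongrightarrow> 0" for n
    using LIMSEQ_inverse_real_of_nat by (simp_all add: \<epsilon>_def[abs_def])
  define C where "C n = cauchy_trunc \<mu> f (\<epsilon> n)" for n
  have [measurable]: "C n \<in> borel_measurable \<mu>" for n
    unfolding C_def using fin sets by (rule cauchy_trunc_measurable) measurable
  obtain B where B: "\<And>n. L2_fun \<mu> (C n)" "\<And>n. L2_fun_norm \<mu> (C n) \<le> B"
    using bdd L2 \<epsilon>(1) unfolding cauchy_L2_bounded_def C_def by blast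
  have pairing: "(\<lambda>n. \<integral>\<^sup>+x. ennreal (cmod (f x) * cmod (C n x)) \<partial>\<mu>) \<longlonglongrightarrow> 0"
  proof (rule nn_integral_norm_mult_tendsto_0)
    show "(\<integral>x. (cmod (C n x))\<^sup>2 \<partial>\<mu>) \<le> B\<^sup>2" for n
      using B(2)[of n] unfolding L2_fun_norm_def by (rule sqrt_le_D)
    have \<epsilon>_right: "filterlim \<epsilon> (at_right 0) sequentially"
      using \<epsilon> by (simp add: filterlim_at order_less_imp_not_eq2)
    show "AE x in \<mu>. (\<lambda>n. C n x) \<longlonglongrightarrow> 0"
      using van
    proof eventually_elim
      case (elim x)
      show ?case
        using filterlim_compose[OF elim[unfolded has_cauchy_transform_def] \<epsilon>_right] by (simp add: C_def)
    qed
  qed (use L2 B(1) in \<open>auto simp: L2_fun_def\<close>)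
  \<comment> \<open>A majorant of twice the modulus of the integral of \<open>f * C n\<close>
    against the Cauchy kernel with pole \<open>p s\<close>. Its integral over \<open>N\<close> is
    controlled by the \<open>L^1\<close> norm of \<open>f * C n\<close>, which tends to 0.\<close>
  define u where "u n s = 2 * (\<integral>\<^sup>+a. ennreal (cmod (f a) * cmod (C n a) / cmod (a - p s)) \<partial>\<mu>)" for n s
  have [measurable]: "u n \<in> borel_measurable N" for n
    unfolding u_def by measurable
  have u_le: "(\<integral>\<^sup>+s. u n s \<partial>N) \<le> 2 * (K * (\<integral>\<^sup>+x. ennreal (cmod (f x) * cmod (C n x)) \<partial>\<mu>))" for n
    unfolding u_def
    by (subst nn_integral_cmult, measurable)
       (intro mult_left_mono nn_integral_potential_le fin sets N p K(1), auto)
  have "(\<lambda>n. 2 * (K * (\<integral>\<^sup>+x. ennreal (cmod (f x) * cmod (C n x)) \<partial>\<mu>))) \<longlonglongrightarrow> 2 * (K * 0)"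
    by (intro tendsto_mult_ennreal tendsto_const pairing) (use K(2) in auto)
  then have "(\<lambda>n. 2 * (K * (\<integral>\<^sup>+x. ennreal (cmod (f x) * cmod (C n x)) \<partial>\<mu>))) \<longlonglongrightarrow> 0"
    by simp
  then have "(\<lambda>n. \<integral>\<^sup>+s. u n s \<partial>N) \<longlonglongrightarrow> 0"
    by (rule tendsto_sandwich[OF _ _ tendsto_const, rotated 2])
       (rule always_eventually, simp, rule always_eventually, rule allI, rule u_le)
  \<comment> \<open>Fatou's lemma turns the vanishing of the integrals into a pointwise statement; a
    zero lower limit is enough, since the modulus of the squared Cauchy integral is a genuine limit
    lying below it.\<close>
  then have "(\<integral>\<^sup>+s. liminf (\<lambda>n. u n s) \<partial>N) \<le> 0"
    using nn_integral_liminf[of u N] by (simp add: lim_imp_Liminf)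
  then have liminf0: "AE s in N. liminf (\<lambda>n. u n s) = 0"
    by (subst (asm) le_zero_eq, subst (asm) nn_integral_0_iff_AE) auto
  have "(\<integral>\<^sup>+s. \<integral>\<^sup>+\<zeta>. ennreal (cmod (f \<zeta> / (\<zeta> - p s))) \<partial>\<mu> \<partial>N) < \<infinity>"
    by (rule nn_integral_potential_finite) fact+
  then have "AE s in N. (\<integral>\<^sup>+\<zeta>. ennreal (cmod (f \<zeta> / (\<zeta> - p s))) \<partial>\<mu>) \<noteq> \<infinity>"
    by (intro nn_integral_PInf_AE) auto
  with liminf0 show ?thesis
  proof eventually_elim
    case (elim s)
    let ?F = "\<integral>a. f a / (a - p s) \<partial>\<mu>"
    define G where "G n = 2 * (\<integral>a. f a / (a - p s) * C n a \<partial>\<mu>)" for n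
    have h: "integrable \<mu> (\<lambda>a. f a / (a - p s))"
      using elim(2) by (simp add: integrable_iff_bounded top.not_eq_extremum)
    have "G \<longlonglongrightarrow> ?F\<^sup>2"
      unfolding G_def C_def
      by (rule cauchy_trunc_pairing_tendsto) (use fin sets no_atoms f h \<epsilon> in auto)
    then have "(\<lambda>n. ennreal (cmod (G n))) \<longlonglongrightarrow> ennreal (cmod (?F\<^sup>2))"
      by (intro tendsto_ennrealI tendsto_norm)
    then have "ennreal (cmod (?F\<^sup>2)) = liminf (\<lambda>n. ennreal (cmod (G n)))"
      by (rule lim_imp_Liminf[OF sequentially_bot, symmetric])
    also have "\<dots> \<le> liminf (\<lambda>n. u n s)"
    proof (intro Liminf_mono always_eventually allI)
      fix n
      have "ennreal (cmod (G n)) = 2 * ennreal (cmod (\<integral>a. f a / (a - p s) * C n a \<partial>\<mu>))"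
        by (simp add: G_def norm_mult ennreal_mult)
      also have "\<dots> \<le> u n s"
      \<comment> \<open>A non-integrable integrand has Bochner integral 0 by default, and the bound
        is then trivial.\<close>
      proof (cases "integrable \<mu> (\<lambda>a. f a / (a - p s) * C n a)")
        case True
        show ?thesis unfolding u_def
          using integral_norm_bound_ennreal[OF True]
          by (intro mult_left_mono) (auto simp: norm_mult norm_divide)
      qed (simp add: not_integrable_integral_eq)
      finally show "ennreal (cmod (G n)) \<le> u n s" .
    qed
    also have "\<dots> = 0" by fact
    finally show ?case by simp
  qed
qed

section \<open>Restriction of area-a.e. vanishing to lines\<close>

text \<open>Bounded intervals are used because the kernel \<open>1 / |\<zeta> - z|\<close> has
  infinite integral over the whole plane, so that no finite \<open>K\<close> would exist
  there.\<close>

definition sym_interval :: "nat \<Rightarrow> real measure" where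
  "sym_interval n = restrict_space lborel {-real n..real n}"

lemma finite_measure_sym_interval: "finite_measure (sym_interval n)"
  by (rule finite_measureI) (simp add: sym_interval_def emeasure_restrict_space space_restrict_space)

lemma measurable_sym_interval: "f \<in> borel_measurable borel \<Longrightarrow> f \<in> borel_measurable (sym_interval n)"
  by (simp add: sym_interval_def measurable_restrict_space1)

lemma AE_sym_interval: "(AE x in sym_interval n. P x) \<longleftrightarrow> (AE x in lborel. \<bar>x\<bar> \<le> real n \<longrightarrow> P x)"
proof -
  have "x \<in> {-real n..real n} \<longleftrightarrow> \<bar>x\<bar> \<le> real n" for x by auto
  then show ?thesis
    unfolding sym_interval_def by (subst AE_restrict_space_iff) (simp_all del: atLeastAtMost_iff)
qed

text \<open>Within distance 1 of \<open>a\<close> the singularity contributes at most 2 on either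
  side; farther away the integrand is at most 1 and contributes at most the length
  \<open>2 * real n\<close>. The bound does not depend on \<open>a\<close>.\<close>

lemma nn_integral_inverse_sqrt_le:
  "(\<integral>\<^sup>+x. inverse (ennreal (sqrt \<bar>x - a\<bar>)) \<partial>sym_interval n) \<le> ennreal (2 * real n + 4)"
proof -
  define q where "q t = inverse (ennreal (sqrt \<bar>t\<bar>))" for t
  have [measurable]: "q \<in> borel_measurable borel" unfolding q_def by measurable
  have half: "(\<integral>\<^sup>+t. q t * indicator {0..1} t \<partial>lborel) = 2"
  proof -
    have "((\<lambda>t. if t \<in> {0..1} then t powr (-1/2) else 0) has_integral (1 powr (-1/2 + 1) / (-1/2 + 1::real))) UNIV"
      unfolding has_integral_restrict_UNIV by (rule has_integral_powr_from_0) auto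
    then have *: "(\<integral>\<^sup>+t. ennreal (if t \<in> {0..1} then t powr (-1/2) else 0) \<partial>lborel) = ennreal 2"
      by (intro nn_integral_has_integral_lborel) auto
    \<comment> \<open>At 0 the two integrands differ: \<open>q\<close> is infinite there, while
      \<open>0 powr (-1/2)\<close> is 0.\<close>
    have "AE t in lborel. t \<noteq> (0::real)" by (rule AE_lborel_singleton)
    then have "(\<integral>\<^sup>+t. q t * indicator {0..1} t \<partial>lborel) =
        (\<integral>\<^sup>+t. ennreal (if t \<in> {0..1} then t powr (-1/2) else 0) \<partial>lborel)"
    proof (intro nn_integral_cong_AE, eventually_elim)
      case (elim t)
      then show ?case
        by (auto simp: q_def indicator_def inverse_ennreal powr_minus powr_half_sqrt)
    qed
    with * show ?thesis by simp
  qed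
  have half': "(\<integral>\<^sup>+t. q t * indicator {-1..0} t \<partial>lborel) = 2"
  proof -
    have "(\<integral>\<^sup>+t. q t * indicator {-1..0} t \<partial>lborel)
        = (\<integral>\<^sup>+t. q (0 + (-1) * t) * indicator {-1..0} (0 + (-1) * t) \<partial>lborel)"
      by (subst nn_integral_real_affine[where c="-1" and t=0]) auto
    also have "\<dots> = (\<integral>\<^sup>+t. q t * indicator {0..1} t \<partial>lborel)"
      by (intro nn_integral_cong) (auto simp: q_def indicator_def)
    finally show ?thesis using half by simp
  qed
  have "(\<integral>\<^sup>+x. q (x - a) \<partial>sym_interval n) = (\<integral>\<^sup>+x. q (x - a) * indicator {-real n..real n} x \<partial>lborel)"
    by (simp add: sym_interval_def nn_integral_restrict_space)
  also have "\<dots> \<le> (\<integral>\<^sup>+x. indicator {-real n..real n} x + q (x - a) * indicator {0..1} (x - a) +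
        q (x - a) * indicator {-1..0} (x - a) \<partial>lborel)"
  proof (rule nn_integral_mono)
    fix x
    show "q (x - a) * indicator {-real n..real n} x \<le> indicator {-real n..real n} x +
        q (x - a) * indicator {0..1} (x - a) + q (x - a) * indicator {-1..0} (x - a)"
    proof (cases "\<bar>x - a\<bar> \<le> 1")
      case True
      then have "x - a \<in> {0..1} \<or> x - a \<in> {-1..0}" by auto
      then show ?thesis by (auto simp: indicator_def add_increasing add_increasing2)
    next
      case False
      then have "inverse (sqrt \<bar>x - a\<bar>) \<le> 1" by (intro inverse_le_1_iff[THEN iffD2]) auto
      then have "q (x - a) \<le> 1" using False unfolding q_def
        by (subst inverse_ennreal) auto
      then show ?thesis by (auto simp: indicator_def)
    qed
  qed
  also have "\<dots> = ennreal (2 * real n) + (\<integral>\<^sup>+x. q (x - a) * indicator {0..1} (x - a) \<partial>lborel) +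
        (\<integral>\<^sup>+x. q (x - a) * indicator {-1..0} (x - a) \<partial>lborel)"
    by (simp add: nn_integral_add)
  also have "(\<integral>\<^sup>+x. q (x - a) * indicator {0..1} (x - a) \<partial>lborel) = 2"
    using half nn_integral_real_affine[where c=1 and t="-a" and f="\<lambda>t. q t * indicator {0..1} t"] by simp
  also have "(\<integral>\<^sup>+x. q (x - a) * indicator {-1..0} (x - a) \<partial>lborel) = 2"
    using half' nn_integral_real_affine[where c=1 and t="-a" and f="\<lambda>t. q t * indicator {-1..0} t"] by simp
  also have "ennreal (2 * real n) + 2 + 2 = ennreal (2 * real n + 4)"
    by (simp add: ennreal_plus add.assoc)
  finally show ?thesis by (simp add: q_def)
qed

text \<open>The map \<open>p\<close> is left general so that vertical and horizontal lines share one
  proof. The condition \<open>dist\<close> bounds the planar kernel by a product of two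
  one-dimensional inverse square roots, so Tonelli's theorem gives a finite \<open>K\<close> on each
  square. Countably many \<open>n\<close> leave a single exceptional null set of lines.\<close>

proposition cauchy_integral_eq_0_on_lines:
  fixes p :: "real \<Rightarrow> real \<Rightarrow> complex"
  assumes fin: "finite_measure \<mu>" and sets: "sets \<mu> = sets borel"
    and no_atoms: "\<And>z. measure \<mu> {z} = 0"
    and bdd: "cauchy_L2_bounded \<mu>" and L2: "L2_fun \<mu> f"
    and van: "AE z in \<mu>. has_cauchy_transform \<mu> f z 0"
    and p[measurable]: "(\<lambda>(x, y). p x y) \<in> borel_measurable borel"
    and dist: "\<And>\<zeta>. \<exists>u v. \<forall>x y. \<bar>x - u\<bar> * \<bar>y - v\<bar> \<le> (cmod (\<zeta> - p x y))\<^sup>2"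
  shows "AE x in lborel. \<forall>n. \<bar>x\<bar> \<le> real n \<longrightarrow>
      (AE y in sym_interval n. (\<integral>\<zeta>. f \<zeta> / (\<zeta> - p x y) \<partial>\<mu>) = 0) \<and>
      (\<integral>\<^sup>+y. \<integral>\<^sup>+\<zeta>. ennreal (cmod (f \<zeta> / (\<zeta> - p x y))) \<partial>\<mu> \<partial>sym_interval n) < \<infinity>"
proof (subst AE_all_countable, rule allI)
  fix n
  interpret finite_measure \<mu> by fact
  interpret I: finite_measure "sym_interval n" by (rule finite_measure_sym_interval)
  interpret II: pair_sigma_finite "sym_interval n" "sym_interval n" ..
  let ?N = "sym_interval n \<Otimes>\<^sub>M sym_interval n"
  note sets[measurable_cong]
  have f: "integrable \<mu> f" by (rule L2_fun_integrable) fact+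
  then have [measurable]: "f \<in> borel_measurable \<mu>" by auto
  have pN[measurable]: "(\<lambda>(x, y). p x y) \<in> borel_measurable ?N"
  proof -
    have "(\<lambda>s. (fst s, snd s)) \<in> measurable ?N (borel \<Otimes>\<^sub>M borel)"
      by (intro measurable_Pair measurable_compose[OF measurable_fst] measurable_compose[OF measurable_snd] measurable_sym_interval) auto
    from measurable_compose[OF this, of "\<lambda>(x, y). p x y" borel] p show ?thesis
      by (simp add: borel_prod)
  qed
  define K where "K = ennreal (2 * real n + 4) * ennreal (2 * real n + 4)"
  have K: "(\<integral>\<^sup>+s. ennreal (1 / cmod (\<zeta> - (case s of (x, y) \<Rightarrow> p x y))) \<partial>?N) \<le> K" for \<zeta>
  proof -
    obtain u v where uv: "\<And>x y. \<bar>x - u\<bar> * \<bar>y - v\<bar> \<le> (cmod (\<zeta> - p x y))\<^sup>2"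
      using dist[of \<zeta>] by blast
    define q where "q t = inverse (ennreal (sqrt \<bar>t\<bar>))" for t
    have [measurable]: "q \<in> borel_measurable borel" unfolding q_def by measurable
    have [measurable]: "(\<lambda>x. q (x - w)) \<in> borel_measurable (sym_interval n)" for w
      by (intro measurable_sym_interval) measurable
    \<comment> \<open>Unlike the real inverse, the one in \<open>ennreal\<close> is infinite at 0, so no exceptional points are needed.\<close>
    have le: "ennreal (1 / cmod (\<zeta> - p x y)) \<le> q (x - u) * q (y - v)" for x y
    proof (cases "x = u \<or> y = v")
      case True
      have "q t > 0" for t by (simp add: q_def zero_less_iff_neq_zero)
      with True have "q (x - u) * q (y - v) = \<infinity>"
        by (auto simp: q_def ennreal_mult_top ennreal_top_mult)
      then show ?thesis by simp
    next
      case False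
      then have pos: "0 < sqrt (\<bar>x - u\<bar> * \<bar>y - v\<bar>)" by simp
      have "sqrt (\<bar>x - u\<bar> * \<bar>y - v\<bar>) \<le> cmod (\<zeta> - p x y)"
        using uv by (intro real_le_lsqrt) auto
      then have "1 / cmod (\<zeta> - p x y) \<le> 1 / sqrt (\<bar>x - u\<bar> * \<bar>y - v\<bar>)"
        using pos by (intro divide_left_mono mult_pos_pos) auto
      also have "\<dots> = inverse (sqrt \<bar>x - u\<bar>) * inverse (sqrt \<bar>y - v\<bar>)"
        by (simp add: real_sqrt_mult divide_inverse)
      finally have "ennreal (1 / cmod (\<zeta> - p x y)) \<le> ennreal (inverse (sqrt \<bar>x - u\<bar>) * inverse (sqrt \<bar>y - v\<bar>))"
        by (rule ennreal_leI)
      also have "\<dots> = q (x - u) * q (y - v)"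
        using False by (simp add: q_def inverse_ennreal ennreal_mult)
      finally show ?thesis .
    qed
    have "(\<integral>\<^sup>+s. ennreal (1 / cmod (\<zeta> - (case s of (x, y) \<Rightarrow> p x y))) \<partial>?N) \<le> (\<integral>\<^sup>+(x, y). q (x - u) * q (y - v) \<partial>?N)"
      by (intro nn_integral_mono) (auto simp: le)
    also have "\<dots> = (\<integral>\<^sup>+x. \<integral>\<^sup>+y. q (x - u) * q (y - v) \<partial>sym_interval n \<partial>sym_interval n)"
      by (subst I.nn_integral_fst[symmetric]) auto
    also have "\<dots> = (\<integral>\<^sup>+x. q (x - u) \<partial>sym_interval n) * (\<integral>\<^sup>+y. q (y - v) \<partial>sym_interval n)"
      by (simp add: nn_integral_cmult nn_integral_multc)
    also have "\<dots> \<le> K"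
      unfolding K_def q_def by (intro mult_mono nn_integral_inverse_sqrt_le) auto
    finally show ?thesis .
  qed
  have K_fin: "K < \<infinity>"
    by (simp add: K_def ennreal_mult_less_top)
  have N: "sigma_finite_measure ?N" ..
  have "AE s in ?N. (\<integral>\<zeta>. f \<zeta> / (\<zeta> - (case s of (x, y) \<Rightarrow> p x y)) \<partial>\<mu>) = 0"
    by (rule cauchy_integral_eq_0_AE[OF fin sets no_atoms bdd L2 van N pN K K_fin])
  then have 1: "AE x in sym_interval n. AE y in sym_interval n. (\<integral>\<zeta>. f \<zeta> / (\<zeta> - p x y) \<partial>\<mu>) = 0"
    using II.AE_pair by fastforce
  have "(\<integral>\<^sup>+s. \<integral>\<^sup>+\<zeta>. ennreal (cmod (f \<zeta> / (\<zeta> - (case s of (x, y) \<Rightarrow> p x y)))) \<partial>\<mu> \<partial>?N) < \<infinity>"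
    by (rule nn_integral_potential_finite[OF fin sets N pN f K K_fin])
  moreover have [measurable]: "(\<lambda>s. \<integral>\<^sup>+\<zeta>. ennreal (cmod (f \<zeta> / (\<zeta> - (case s of (x, y) \<Rightarrow> p x y)))) \<partial>\<mu>) \<in> borel_measurable ?N"
    by measurable
  ultimately have "(\<integral>\<^sup>+x. \<integral>\<^sup>+y. \<integral>\<^sup>+\<zeta>. ennreal (cmod (f \<zeta> / (\<zeta> - p x y))) \<partial>\<mu> \<partial>sym_interval n \<partial>sym_interval n) < \<infinity>"
    by (subst (asm) I.nn_integral_fst[symmetric]) simp_all
  then have 2: "AE x in sym_interval n. (\<integral>\<^sup>+y. \<integral>\<^sup>+\<zeta>. ennreal (cmod (f \<zeta> / (\<zeta> - p x y))) \<partial>\<mu> \<partial>sym_interval n) \<noteq> \<infinity>"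
    by (intro nn_integral_PInf_AE) (use I.borel_measurable_nn_integral_fst in auto)
  from 1 2 show "AE x in lborel. \<bar>x\<bar> \<le> real n \<longrightarrow>
      (AE y in sym_interval n. (\<integral>\<zeta>. f \<zeta> / (\<zeta> - p x y) \<partial>\<mu>) = 0) \<and>
      (\<integral>\<^sup>+y. \<integral>\<^sup>+\<zeta>. ennreal (cmod (f \<zeta> / (\<zeta> - p x y))) \<partial>\<mu> \<partial>sym_interval n) < \<infinity>"
    unfolding AE_sym_interval[symmetric] by eventually_elim (simp add: top.not_eq_extremum)
qed

section \<open>Integration along segments and around rectangles\<close>

text \<open>For each fixed \<open>\<zeta>\<close> only one \<open>x\<close> is bad, so exchanging
  the two almost-everywhere quantifiers suffices. With \<open>g\<close> a coordinate, almost every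
  line parallel to an axis has no \<open>\<mu>\<close>-mass.\<close>

lemma AE_lborel_level_set_null:
  fixes g :: "'a \<Rightarrow> real"
  assumes "sigma_finite_measure \<mu>" and [measurable]: "g \<in> borel_measurable \<mu>"
  shows "AE x in lborel. AE \<zeta> in \<mu>. g \<zeta> \<noteq> x"
proof -
  interpret sigma_finite_measure \<mu> by fact
  interpret pair_sigma_finite \<mu> "lborel :: real measure" ..
  have "AE \<zeta> in \<mu>. AE x in lborel. g \<zeta> \<noteq> x"
  proof (rule AE_I2)
    fix \<zeta> show "AE x in lborel. g \<zeta> \<noteq> x"
      using AE_lborel_singleton[of "g \<zeta>"] by eventually_elim auto
  qed
  then show ?thesis
    by (subst (asm) AE_commute) measurable
qed

text \<open>For \<open>\<gamma>\<close> of constant velocity \<open>e\<close> that avoids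
  \<open>\<zeta>\<close>, \<open>- e\<close> times this value is the contour integral of
  \<open>1 / (v - \<zeta>)\<close>. As a Lebesgue integral it is total: for a nondegenerate segment
  through \<open>\<zeta>\<close> it has the default value 0.\<close>

definition segment_kernel :: "(real \<Rightarrow> complex) \<Rightarrow> real \<Rightarrow> real \<Rightarrow> complex \<Rightarrow> complex" where
  "segment_kernel \<gamma> a b \<zeta> = (LINT t:{a..b}|lborel. 1 / (\<zeta> - \<gamma> t))"

text \<open>Fubini's theorem moves the integral over \<open>\<mu>\<close> inside, where it is the
  Cauchy integral at \<open>\<gamma> t\<close>, zero for almost every \<open>t\<close> in the
  segment. The finite potential \<open>pot\<close> justifies the exchange.\<close>

lemma segment_kernel_pairing:
  assumes fin: "finite_measure \<mu>" and sets: "sets \<mu> = sets borel" and f: "integrable \<mu> f"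
    and [measurable]: "\<gamma> \<in> borel_measurable borel"
    and n: "-real n \<le> a" "b \<le> real n"
    and zero: "AE t in sym_interval n. (\<integral>\<zeta>. f \<zeta> / (\<zeta> - \<gamma> t) \<partial>\<mu>) = 0"
    and pot: "(\<integral>\<^sup>+t. \<integral>\<^sup>+\<zeta>. ennreal (cmod (f \<zeta> / (\<zeta> - \<gamma> t))) \<partial>\<mu> \<partial>sym_interval n) < \<infinity>"
  shows "integrable \<mu> (\<lambda>\<zeta>. f \<zeta> * segment_kernel \<gamma> a b \<zeta>)"
    and "(\<integral>\<zeta>. f \<zeta> * segment_kernel \<gamma> a b \<zeta> \<partial>\<mu>) = 0"
proof -
  interpret M: finite_measure \<mu> by fact
  interpret pair_sigma_finite "lborel :: real measure" \<mu> ..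
  note sets[measurable_cong]
  have [measurable]: "f \<in> borel_measurable \<mu>" using f by auto
  define k where "k = (\<lambda>t \<zeta>. indicator {a..b} t *\<^sub>R (f \<zeta> / (\<zeta> - \<gamma> t)))"
  have [measurable]: "(\<lambda>(t, \<zeta>). k t \<zeta>) \<in> borel_measurable (lborel \<Otimes>\<^sub>M \<mu>)"
    unfolding k_def by measurable
  have "(\<integral>\<^sup>+(t, \<zeta>). ennreal (cmod (k t \<zeta>)) \<partial>(lborel \<Otimes>\<^sub>M \<mu>)) =
      (\<integral>\<^sup>+t. \<integral>\<^sup>+\<zeta>. ennreal (cmod (k t \<zeta>)) \<partial>\<mu> \<partial>lborel)"
    by (subst M.nn_integral_fst[symmetric]) auto
  also have "\<dots> \<le> (\<integral>\<^sup>+t. (\<integral>\<^sup>+\<zeta>. ennreal (cmod (f \<zeta> / (\<zeta> - \<gamma> t))) \<partial>\<mu>) * indicator {-real n..real n} t \<partial>lborel)"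
    using n by (intro nn_integral_mono) (auto simp: k_def indicator_def)
  also have "\<dots> < \<infinity>"
    using pot by (simp add: sym_interval_def nn_integral_restrict_space)
  finally have k: "integrable (lborel \<Otimes>\<^sub>M \<mu>) (\<lambda>(t, \<zeta>). k t \<zeta>)"
    by (simp add: integrable_iff_bounded case_prod_beta')
  have eq: "(\<integral>t. k t \<zeta> \<partial>lborel) = f \<zeta> * segment_kernel \<gamma> a b \<zeta>" for \<zeta>
  proof -
    have "k t \<zeta> = f \<zeta> * (indicator {a..b} t *\<^sub>R (1 / (\<zeta> - \<gamma> t)))" for t
      by (simp add: k_def)
    then show ?thesis
      by (simp only: segment_kernel_def set_lebesgue_integral_def integral_mult_right_zero)
  qed
  show "integrable \<mu> (\<lambda>\<zeta>. f \<zeta> * segment_kernel \<gamma> a b \<zeta>)"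
    using integrable_snd[OF k] by (simp add: eq)
  have "(\<integral>\<zeta>. f \<zeta> * segment_kernel \<gamma> a b \<zeta> \<partial>\<mu>) = (\<integral>t. \<integral>\<zeta>. k t \<zeta> \<partial>\<mu> \<partial>lborel)"
    using Fubini_integral[OF k] by (simp add: eq)
  also have "\<dots> = (\<integral>t. 0 \<partial>(lborel :: real measure))"
  proof (rule integral_cong_AE)
    have "AE t in lborel. \<bar>t\<bar> \<le> real n \<longrightarrow> (\<integral>\<zeta>. f \<zeta> / (\<zeta> - \<gamma> t) \<partial>\<mu>) = 0"
      using zero by (simp add: AE_sym_interval)
    then show "AE t in lborel. (\<integral>\<zeta>. k t \<zeta> \<partial>\<mu>) = 0"
    proof eventually_elim
      case (elim t)
      then show ?case
        using n by (cases "t \<in> {a..b}") (auto simp: k_def)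
    qed
  qed measurable
  finally show "(\<integral>\<zeta>. f \<zeta> * segment_kernel \<gamma> a b \<zeta> \<partial>\<mu>) = 0" by simp
qed

text \<open>The form \<open>w + of_real t * e\<close> covers horizontal sides with
  \<open>e = 1\<close> and vertical ones with \<open>e = \<i>\<close>. The minus sign comes from the
  opposite orders \<open>\<zeta> - \<gamma> t\<close> and \<open>v - \<zeta>\<close>.\<close>

lemma has_contour_integral_segment_kernel:
  assumes "a < b" and "e \<noteq> 0" and off: "\<And>t. t \<in> {a..b} \<Longrightarrow> \<zeta> \<noteq> w + of_real t * e"
  shows "((\<lambda>v. 1 / (v - \<zeta>)) has_contour_integral - (e * segment_kernel (\<lambda>t. w + of_real t * e) a b \<zeta>))
           (linepath (w + of_real a * e) (w + of_real b * e))"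
proof -
  define S where "S = segment_kernel (\<lambda>t. w + of_real t * e) a b \<zeta>"
  have cont: "continuous_on {a..b} (\<lambda>t. 1 / (\<zeta> - (w + of_real t * e)))"
    using off by (intro continuous_intros) auto
  note int = borel_integrable_atLeastAtMost'[OF cont]
  have sc: "- (of_real (b - a) * e) * (S /\<^sub>R (b - a)) = - (e * S)"
    using \<open>a < b\<close> by (simp add: scaleR_conv_of_real del: of_real_diff)
  have "((\<lambda>t. 1 / (\<zeta> - (w + of_real t * e))) has_integral S) (cbox a b)"
    using set_borel_integral_eq_integral[OF int]
    by (simp add: S_def segment_kernel_def has_integral_integrable_integral)
  \<comment> \<open>Rescaling to the unit interval divides the integral by \<open>b - a\<close>; the
    velocity \<open>(b - a) * e\<close> of the line path cancels this factor.\<close>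
  from has_integral_affinity'[OF this, of "b - a" a] \<open>a < b\<close>
  have "((\<lambda>x. 1 / (\<zeta> - (w + of_real ((b - a) * x + a) * e))) has_integral S /\<^sub>R (b - a)) {0..1}"
    by simp
  from has_integral_mult_right[OF this, of "- (of_real (b - a) * e)"]
  have *: "((\<lambda>x. - (of_real (b - a) * e) * (1 / (\<zeta> - (w + of_real ((b - a) * x + a) * e)))) has_integral - (e * S)) {0..1}"
    by (simp only: sc)
  have "((\<lambda>x. 1 / (linepath (w + of_real a * e) (w + of_real b * e) x - \<zeta>) * (w + of_real b * e - (w + of_real a * e)))
      has_integral - (e * S)) {0..1}"
  proof (rule has_integral_eq[OF _ *])
    fix x :: real
    have 1: "linepath (w + of_real a * e) (w + of_real b * e) x - \<zeta> = - (\<zeta> - (w + of_real ((b - a) * x + a) * e))"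
      by (simp add: linepath_def scaleR_conv_of_real algebra_simps)
    have 2: "w + of_real b * e - (w + of_real a * e) = of_real (b - a) * e"
      by (simp add: algebra_simps)
    show "- (of_real (b - a) * e) * (1 / (\<zeta> - (w + of_real ((b - a) * x + a) * e))) =
      1 / (linepath (w + of_real a * e) (w + of_real b * e) x - \<zeta>) * (w + of_real b * e - (w + of_real a * e))"
      unfolding 1 2 by (simp only: divide_minus_right mult_minus_left mult_minus_right mult.commute)
  qed
  then show ?thesis
    by (simp add: has_contour_integral_linepath S_def)
qed

text \<open>The left side is minus the contour integral of \<open>1 / (v - \<zeta>)\<close> around
  the rectangle, which the winding number evaluates. Keeping \<open>\<zeta>\<close> off the four
  full lines makes every kernel a genuine contour integral.\<close>

lemma rectangle_segment_kernels:
  assumes "a < b" "c < d" and \<zeta>: "Re \<zeta> \<notin> {a, b}" "Im \<zeta> \<notin> {c, d}"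
  shows "segment_kernel (\<lambda>t. Complex t c) a b \<zeta> + \<i> * segment_kernel (\<lambda>t. Complex b t) c d \<zeta>
       - segment_kernel (\<lambda>t. Complex t d) a b \<zeta> - \<i> * segment_kernel (\<lambda>t. Complex a t) c d \<zeta>
       = - (2 * pi * \<i>) * indicator (box (Complex a c) (Complex b d)) \<zeta>"
proof -
  let ?f = "\<lambda>v. 1 / (v - \<zeta>)"
  let ?R = "rectpath (Complex a c) (Complex b d)"
  have H: "(?f has_contour_integral - segment_kernel (\<lambda>t. Complex t y) a b \<zeta>) (linepath (Complex a y) (Complex b y))"
    if "Im \<zeta> \<noteq> y" for y
  proof -
    have C: "\<i> * of_real y + of_real t * 1 = Complex t y" for t
      by (simp add: complex_eq_iff)
    have "\<zeta> \<noteq> \<i> * of_real y + of_real t * 1" for t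
      unfolding C using that by auto
    from has_contour_integral_segment_kernel[OF \<open>a < b\<close> one_neq_zero, of \<zeta> "\<i> * of_real y", OF this]
    show ?thesis unfolding C by simp
  qed
  have V: "(?f has_contour_integral - (\<i> * segment_kernel (\<lambda>t. Complex x t) c d \<zeta>)) (linepath (Complex x c) (Complex x d))"
    if "Re \<zeta> \<noteq> x" for x
  proof -
    have C: "of_real x + of_real t * \<i> = Complex x t" for t
      by (simp add: complex_eq_iff)
    have "\<zeta> \<noteq> of_real x + of_real t * \<i>" for t
      unfolding C using that by auto
    from has_contour_integral_segment_kernel[OF \<open>c < d\<close> complex_i_not_zero, of \<zeta> "of_real x", OF this]
    show ?thesis unfolding C by simp
  qed
  \<comment> \<open>The summands follow \<open>rectpath\<close>: bottom, right, then top and left,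
    both traversed backwards.\<close>
  have "(?f has_contour_integral
      (- segment_kernel (\<lambda>t. Complex t c) a b \<zeta> + (- (\<i> * segment_kernel (\<lambda>t. Complex b t) c d \<zeta>) +
        (- (- segment_kernel (\<lambda>t. Complex t d) a b \<zeta>) + - (- (\<i> * segment_kernel (\<lambda>t. Complex a t) c d \<zeta>)))))) ?R"
    unfolding rectpath_def Let_def complex.sel using \<zeta>
    by (intro has_contour_integral_join has_contour_integral_reverse_linepath H V valid_path_join) auto
  then have ci: "contour_integral ?R ?f = - (segment_kernel (\<lambda>t. Complex t c) a b \<zeta> + \<i> * segment_kernel (\<lambda>t. Complex b t) c d \<zeta>
       - segment_kernel (\<lambda>t. Complex t d) a b \<zeta> - \<i> * segment_kernel (\<lambda>t. Complex a t) c d \<zeta>)"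
    by (subst contour_integral_unique) (auto simp: algebra_simps)
  have notin: "\<zeta> \<notin> path_image ?R"
    using assms by (subst path_image_rectpath) auto
  have "winding_number ?R \<zeta> = indicator (box (Complex a c) (Complex b d)) \<zeta>"
  proof (cases "\<zeta> \<in> box (Complex a c) (Complex b d)")
    case True
    then show ?thesis by (simp add: winding_number_rectpath)
  next
    case False
    then have "\<zeta> \<notin> cbox (Complex a c) (Complex b d)"
      using \<zeta> by (auto simp: in_box_complex_iff in_cbox_complex_iff)
    with False show ?thesis
      using assms by (simp add: winding_number_rectpath_outside)
  qed
  moreover have "winding_number ?R \<zeta> = 1 / (2 * pi * \<i>) * contour_integral ?R ?f"
    by (rule winding_number_valid_path[OF _ notin]) simp
  ultimately have "contour_integral ?R ?f = 2 * pi * \<i> * indicator (box (Complex a c) (Complex b d)) \<zeta>"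
    by (simp add: field_simps)
  then show ?thesis using ci by (simp add: algebra_simps neg_eq_iff_add_eq_0)
qed

section \<open>Recovering the density from integrals over boxes\<close>

text \<open>A set of full Lebesgue measure meets every nonempty open interval. This supplies good
  sides arbitrarily close to those of a given box.\<close>

lemma exists_AE_lborel_approx:
  fixes P :: "real \<Rightarrow> bool"
  assumes "AE x in lborel. P x"
  shows "\<exists>x. (\<forall>n. P (x n) \<and> a < x n) \<and> x \<longlonglongrightarrow> a"
    and "\<exists>x. (\<forall>n. P (x n) \<and> x n < a) \<and> x \<longlonglongrightarrow> a"
proof -
  have ex: "\<exists>x. l < x \<and> x < r \<and> P x" if "l < r" for l r
  proof (rule ccontr)
    assume none: "\<not> (\<exists>x. l < x \<and> x < r \<and> P x)"
    have "AE x in lborel. x \<notin> {l<..<r}"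
      using assms by eventually_elim (use none in auto)
    then have "{l<..<r} \<in> null_sets lborel"
      by (subst AE_iff_null_sets) auto
    then show False using that by (simp add: null_sets_def)
  qed
  have "\<exists>x. \<forall>n. a < x n \<and> x n < a + inverse (real (Suc n)) \<and> P (x n)"
    by (intro choice allI ex) simp
  then obtain x where x: "\<And>n. a < x n" "\<And>n. x n < a + inverse (real (Suc n))" "\<And>n. P (x n)"
    by blast
  have "x \<longlonglongrightarrow> a"
    by (rule tendsto_sandwich[OF _ _ tendsto_const LIMSEQ_inverse_real_of_nat_add])
       (use x in \<open>auto intro!: always_eventually less_imp_le\<close>)
  then show "\<exists>x. (\<forall>n. P (x n) \<and> a < x n) \<and> x \<longlonglongrightarrow> a"
    using x by blast
  have "\<exists>x. \<forall>n. a + - inverse (real (Suc n)) < x n \<and> x n < a \<and> P (x n)"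
    by (intro choice allI ex) simp
  then obtain y where y: "\<And>n. y n < a" "\<And>n. a + - inverse (real (Suc n)) < y n" "\<And>n. P (y n)"
    by blast
  have "y \<longlonglongrightarrow> a"
    by (rule tendsto_sandwich[OF _ _ LIMSEQ_inverse_real_of_nat_add_minus tendsto_const])
       (use y in \<open>auto intro!: always_eventually less_imp_le\<close>)
  then show "\<exists>x. (\<forall>n. P (x n) \<and> x n < a) \<and> x \<longlonglongrightarrow> a"
    using y by blast
qed

text \<open>Boxes form an intersection-stable generator of the Borel sets, so Dynkin's argument
  carries vanishing integrals over to every Borel set.\<close>

lemma AE_eq_0_of_box_integrals:
  fixes f :: "'a::euclidean_space \<Rightarrow> complex"
  assumes "sigma_finite_measure \<mu>" and sets: "sets \<mu> = sets borel" and f: "integrable \<mu> f"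
    and box: "\<And>a b. (LINT x:box a b|\<mu>. f x) = 0"
  shows "AE x in \<mu>. f x = 0"
proof (rule sigma_finite_measure.density_zero[OF assms(1) f])
  have space: "space \<mu> = UNIV" using sets_eq_imp_space_eq[OF sets] by simp
  have borel: "sets borel = sigma_sets UNIV (range (\<lambda>(a, b). box a b :: 'a set))"
    by (subst borel_eq_box) (simp add: sets_measure_of_conv)
  have set_int: "set_integrable \<mu> A f" if "A \<in> sets \<mu>" for A
    using f that by (simp add: set_integrable_def integrable_mult_indicator)
  \<comment> \<open>The complement case below subtracts from the integral over the whole space,
    which is itself a limit over growing boxes.\<close>
  have total: "(LINT x:UNIV|\<mu>. f x) = 0"
  proof -
    define B where "B n = box (- (real n *\<^sub>R One)) (real n *\<^sub>R One :: 'a)" for n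
    have un: "(\<Union>n. B n) = UNIV"
      unfolding B_def by (rule UN_box_eq_UNIV)
    have "(\<lambda>n. LINT x:B n|\<mu>. f x) \<longlonglongrightarrow> (LINT x:(\<Union>n. B n)|\<mu>. f x)"
    proof (rule set_integral_cont_up)
      show "incseq B"
        by (fastforce simp: incseq_def B_def box_def)
    qed (auto simp: sets B_def un intro!: set_int)
    then show ?thesis unfolding un by (simp add: B_def box LIMSEQ_const_iff)
  qed
  fix A assume "A \<in> sets \<mu>"
  then have A: "A \<in> sigma_sets UNIV (range (\<lambda>(a, b). box a b :: 'a set))"
    by (simp add: sets borel)
  have stable: "Int_stable (range (\<lambda>(a, b). box a b :: 'a set))"
    by (auto simp: Int_stable_def box_Int_box)
  have closed: "range (\<lambda>(a, b). box a b :: 'a set) \<subseteq> Pow UNIV" by simp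
  from stable closed A show "(LINT x:A|\<mu>. f x) = 0"
  proof (induction rule: sigma_sets_induct_disjoint)
    case (basic A) then show ?case using box by auto
  next
    case empty then show ?case by (simp add: set_lebesgue_integral_def)
  next
    case (compl A)
    then have A: "A \<in> sets \<mu>" by (simp add: sets borel)
    have "(LINT x:UNIV|\<mu>. f x) = (LINT x:A \<union> (UNIV - A)|\<mu>. f x)" by simp
    also have "\<dots> = (LINT x:A|\<mu>. f x) + (LINT x:UNIV - A|\<mu>. f x)"
      using A by (intro set_integral_Un set_int) (auto simp: sets)
    finally show ?case using total compl by simp
  next
    case (union A)
    then have A: "A i \<in> sets \<mu>" for i by (auto simp: sets borel)
    have "(LINT x:(\<Union>i. A i)|\<mu>. f x) = (\<Sum>i. LINT x:A i|\<mu>. f x)"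
      using A union(1) by (intro lebesgue_integral_countable_add set_int sets.countable_UN) (auto simp: disjoint_family_on_def)
    then show ?case using union by simp
  qed
qed

definition cauchy_null_line :: "complex measure \<Rightarrow> (complex \<Rightarrow> complex) \<Rightarrow> (real \<Rightarrow> complex) \<Rightarrow> nat \<Rightarrow> bool" where
  "cauchy_null_line \<mu> f \<gamma> n \<longleftrightarrow> (AE t in sym_interval n. (\<integral>\<zeta>. f \<zeta> / (\<zeta> - \<gamma> t) \<partial>\<mu>) = 0) \<and>
      (\<integral>\<^sup>+t. \<integral>\<^sup>+\<zeta>. ennreal (cmod (f \<zeta> / (\<zeta> - \<gamma> t))) \<partial>\<mu> \<partial>sym_interval n) < \<infinity>"

text \<open>Multiplying the rectangle identity by \<open>f\<close> and integrating over
  \<open>\<mu>\<close>, each side contributes 0. The identity holds \<open>\<mu>\<close>-a.e.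
  because the lines through the sides have no mass.\<close>

lemma box_integral_eq_0:
  assumes fin: "finite_measure \<mu>" and sets: "sets \<mu> = sets borel" and f: "integrable \<mu> f"
    and X: "\<And>x. x \<in> {a, b} \<Longrightarrow> (\<forall>n. \<bar>x\<bar> \<le> real n \<longrightarrow> cauchy_null_line \<mu> f (Complex x) n) \<and> (AE \<zeta> in \<mu>. Re \<zeta> \<noteq> x)"
    and Y: "\<And>y. y \<in> {c, d} \<Longrightarrow> (\<forall>n. \<bar>y\<bar> \<le> real n \<longrightarrow> cauchy_null_line \<mu> f (\<lambda>x. Complex x y) n) \<and> (AE \<zeta> in \<mu>. Im \<zeta> \<noteq> y)"
  shows "(LINT \<zeta>:box (Complex a c) (Complex b d)|\<mu>. f \<zeta>) = 0"
proof (cases "a < b \<and> c < d")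
  case False
  then have "box (Complex a c) (Complex b d) = {}"
    by (auto simp: in_box_complex_iff)
  then show ?thesis by (simp add: set_lebesgue_integral_def)
next
  case True
  note sets[measurable_cong]
  have [measurable]: "f \<in> borel_measurable \<mu>" using f by auto
  have sides: "AE \<zeta> in \<mu>. Re \<zeta> \<noteq> a" "AE \<zeta> in \<mu>. Re \<zeta> \<noteq> b" "AE \<zeta> in \<mu>. Im \<zeta> \<noteq> c" "AE \<zeta> in \<mu>. Im \<zeta> \<noteq> d"
    using X Y by blast+
  \<comment> \<open>One \<open>n\<close> bounds both the positions of the four lines and the
    parameter ranges of the sides on them.\<close>
  obtain n where "Max {\<bar>a\<bar>, \<bar>b\<bar>, \<bar>c\<bar>, \<bar>d\<bar>} \<le> real n" using real_arch_simple by blast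
  then have n: "\<bar>a\<bar> \<le> real n" "\<bar>b\<bar> \<le> real n" "\<bar>c\<bar> \<le> real n" "\<bar>d\<bar> \<le> real n" by auto
  have meas [measurable]: "Complex x \<in> borel_measurable borel" "(\<lambda>x. Complex x y) \<in> borel_measurable borel" for x y
    by (auto intro!: borel_measurable_continuous_onI continuous_intros)
  have V: "integrable \<mu> (\<lambda>\<zeta>. f \<zeta> * segment_kernel (Complex x) c d \<zeta>)"
    "(\<integral>\<zeta>. f \<zeta> * segment_kernel (Complex x) c d \<zeta> \<partial>\<mu>) = 0" if "x \<in> {a, b}" for x
    using X[OF that] n that
    by (auto intro!: segment_kernel_pairing[OF fin sets f meas(1), of n] simp: cauchy_null_line_def)
  have H: "integrable \<mu> (\<lambda>\<zeta>. f \<zeta> * segment_kernel (\<lambda>x. Complex x y) a b \<zeta>)"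
    "(\<integral>\<zeta>. f \<zeta> * segment_kernel (\<lambda>x. Complex x y) a b \<zeta> \<partial>\<mu>) = 0" if "y \<in> {c, d}" for y
    using Y[OF that] n that
    by (auto intro!: segment_kernel_pairing[OF fin sets f meas(2), of n] simp: cauchy_null_line_def)
  let ?B = "box (Complex a c) (Complex b d)"
  let ?S = "\<lambda>\<zeta>. f \<zeta> * segment_kernel (\<lambda>x. Complex x c) a b \<zeta> + \<i> * (f \<zeta> * segment_kernel (Complex b) c d \<zeta>)
       - f \<zeta> * segment_kernel (\<lambda>x. Complex x d) a b \<zeta> - \<i> * (f \<zeta> * segment_kernel (Complex a) c d \<zeta>)"
  have "(\<integral>\<zeta>. ?S \<zeta> \<partial>\<mu>) = 0"
    using V H by simp
  moreover have "(\<integral>\<zeta>. ?S \<zeta> \<partial>\<mu>) = (\<integral>\<zeta>. - (2 * pi * \<i>) * (indicator ?B \<zeta> *\<^sub>R f \<zeta>) \<partial>\<mu>)"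
  proof (rule integral_cong_AE)
    show "AE \<zeta> in \<mu>. ?S \<zeta> = - (2 * pi * \<i>) * (indicator ?B \<zeta> *\<^sub>R f \<zeta>)"
      using sides
    proof eventually_elim
      case (elim \<zeta>)
      have "?S \<zeta> = f \<zeta> * (segment_kernel (\<lambda>t. Complex t c) a b \<zeta> + \<i> * segment_kernel (\<lambda>t. Complex b t) c d \<zeta>
       - segment_kernel (\<lambda>t. Complex t d) a b \<zeta> - \<i> * segment_kernel (\<lambda>t. Complex a t) c d \<zeta>)"
        by (simp add: algebra_simps)
      also have "\<dots> = f \<zeta> * (- (2 * pi * \<i>) * indicator ?B \<zeta>)"
        using True elim by (subst rectangle_segment_kernels) auto
      finally show ?case by (simp add: indicator_def)
    qed
    show "?S \<in> borel_measurable \<mu>"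
      by (intro borel_measurable_integrable Bochner_Integration.integrable_diff Bochner_Integration.integrable_add
          integrable_mult_right V(1) H(1)) auto
  qed measurable
  ultimately have "- (2 * pi * \<i>) * (LINT \<zeta>:?B|\<mu>. f \<zeta>) = 0"
    by (simp only: integral_mult_right_zero set_lebesgue_integral_def)
  then show ?thesis by simp
qed

section \<open>Injectivity of the Cauchy transform\<close>

theorem corollary2p5:
  fixes \<mu> :: "complex measure" and f :: "complex \<Rightarrow> complex"
  assumes "finite_measure \<mu>" and "sets \<mu> = sets borel"
    and no_atoms: "\<And>z. measure \<mu> {z} = 0"
    and "cauchy_L2_bounded \<mu>"
    and "L2_fun \<mu> f"
    and "AE z in \<mu>. has_cauchy_transform \<mu> f z 0"
  shows "AE z in \<mu>. f z = 0"
proof -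
  interpret finite_measure \<mu> by fact
  note assms(2)[measurable_cong]
  have f: "integrable \<mu> f" by (rule L2_fun_integrable) fact+
  then have [measurable]: "f \<in> borel_measurable \<mu>" by auto
  have \<sigma>_finite: "sigma_finite_measure \<mu>" ..
  have prod_le: "\<bar>s\<bar> * \<bar>t\<bar> \<le> s\<^sup>2 + t\<^sup>2" for s t :: real
    using sum_squares_bound[of "\<bar>s\<bar>" "\<bar>t\<bar>"] mult_nonneg_nonneg[of "\<bar>s\<bar>" "\<bar>t\<bar>"]
    unfolding power2_abs by linarith
  define PX where "PX x \<longleftrightarrow> (\<forall>n. \<bar>x\<bar> \<le> real n \<longrightarrow> cauchy_null_line \<mu> f (Complex x) n) \<and> (AE \<zeta> in \<mu>. Re \<zeta> \<noteq> x)" for x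
  define PY where "PY y \<longleftrightarrow> (\<forall>n. \<bar>y\<bar> \<le> real n \<longrightarrow> cauchy_null_line \<mu> f (\<lambda>x. Complex x y) n) \<and> (AE \<zeta> in \<mu>. Im \<zeta> \<noteq> y)" for y
  have "AE x in lborel. \<forall>n. \<bar>x\<bar> \<le> real n \<longrightarrow> cauchy_null_line \<mu> f (Complex x) n"
    unfolding cauchy_null_line_def
  proof (rule cauchy_integral_eq_0_on_lines[OF assms])
    show "(\<lambda>(x, y). Complex x y) \<in> borel_measurable borel"
      unfolding case_prod_beta' by (intro borel_measurable_continuous_onI continuous_intros)
    show "\<exists>u v. \<forall>x y. \<bar>x - u\<bar> * \<bar>y - v\<bar> \<le> (cmod (\<zeta> - Complex x y))\<^sup>2" for \<zeta>
      using prod_le by (intro exI[of _ "Re \<zeta>"] exI[of _ "Im \<zeta>"]) (simp add: cmod_power2 power2_commute)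
  qed
  moreover have "AE x in lborel. AE \<zeta> in \<mu>. Re \<zeta> \<noteq> x"
    by (rule AE_lborel_level_set_null[OF \<sigma>_finite]) measurable
  ultimately have X: "AE x in lborel. PX x"
    unfolding PX_def by eventually_elim auto
  have "AE y in lborel. \<forall>n. \<bar>y\<bar> \<le> real n \<longrightarrow> cauchy_null_line \<mu> f (\<lambda>x. Complex x y) n"
    unfolding cauchy_null_line_def
  proof (rule cauchy_integral_eq_0_on_lines[OF assms])
    \<comment> \<open>The coordinates are swapped: the first one is now the height, so the same
      proposition yields horizontal lines.\<close>
    show "(\<lambda>(y, x). Complex x y) \<in> borel_measurable borel"
      unfolding case_prod_beta' by (intro borel_measurable_continuous_onI continuous_intros)
    show "\<exists>u v. \<forall>y x. \<bar>y - u\<bar> * \<bar>x - v\<bar> \<le> (cmod (\<zeta> - Complex x y))\<^sup>2" for \<zeta>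
      using prod_le by (intro exI[of _ "Im \<zeta>"] exI[of _ "Re \<zeta>"]) (simp add: cmod_power2 power2_commute add.commute)
  qed
  moreover have "AE y in lborel. AE \<zeta> in \<mu>. Im \<zeta> \<noteq> y"
    by (rule AE_lborel_level_set_null[OF \<sigma>_finite]) measurable
  ultimately have Y: "AE y in lborel. PY y"
    unfolding PY_def by eventually_elim auto
  have "(LINT \<zeta>:box u v|\<mu>. f \<zeta>) = 0" for u v
  proof -
    obtain a where a: "\<And>n. PX (a n)" "\<And>n. Re u < a n" "a \<longlonglongrightarrow> Re u"
      using exists_AE_lborel_approx(1)[OF X] by blast
    obtain b where b: "\<And>n. PX (b n)" "\<And>n. b n < Re v" "b \<longlonglongrightarrow> Re v"
      using exists_AE_lborel_approx(2)[OF X] by blast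
    obtain c where c: "\<And>n. PY (c n)" "\<And>n. Im u < c n" "c \<longlonglongrightarrow> Im u"
      using exists_AE_lborel_approx(1)[OF Y] by blast
    obtain d where d: "\<And>n. PY (d n)" "\<And>n. d n < Im v" "d \<longlonglongrightarrow> Im v"
      using exists_AE_lborel_approx(2)[OF Y] by blast
    \<comment> \<open>The sides of the given box may lie on exceptional lines, so it is exhausted
      from inside by boxes with good sides. As these stay inside the open box, the indicators
      converge at every point.\<close>
    define B where "B n = box (Complex (a n) (c n)) (Complex (b n) (d n))" for n
    have zero: "(LINT \<zeta>:B n|\<mu>. f \<zeta>) = 0" for n
      unfolding B_def
      by (rule box_integral_eq_0[OF assms(1,2) f]) (use a(1) b(1) c(1) d(1) in \<open>auto simp: PX_def PY_def\<close>)
    have ind: "\<forall>\<^sub>F n in sequentially. indicat_real (B n) \<zeta> = indicator (box u v) \<zeta>" for \<zeta>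
    proof (cases "\<zeta> \<in> box u v")
      case True
      then have "\<forall>\<^sub>F n in sequentially. a n < Re \<zeta>" "\<forall>\<^sub>F n in sequentially. Re \<zeta> < b n"
        "\<forall>\<^sub>F n in sequentially. c n < Im \<zeta>" "\<forall>\<^sub>F n in sequentially. Im \<zeta> < d n"
        using order_tendstoD(2)[OF a(3)] order_tendstoD(1)[OF b(3)] order_tendstoD(2)[OF c(3)] order_tendstoD(1)[OF d(3)]
        by (auto simp: in_box_complex_iff)
      then show ?thesis
        by eventually_elim (use True in \<open>auto simp: B_def in_box_complex_iff\<close>)
    next
      case False
      have "B n \<subseteq> box u v" for n
        using a(2)[of n] b(2)[of n] c(2)[of n] d(2)[of n] by (auto simp: B_def in_box_complex_iff)
      with False show ?thesis by (auto intro!: always_eventually simp: indicator_def)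
    qed
    have "(\<lambda>n. LINT \<zeta>:B n|\<mu>. f \<zeta>) \<longlonglongrightarrow> (LINT \<zeta>:box u v|\<mu>. f \<zeta>)"
      unfolding set_lebesgue_integral_def
    proof (rule integral_dominated_convergence[where w="\<lambda>\<zeta>. cmod (f \<zeta>)"])
      show "(\<lambda>\<zeta>. indicat_real (B n) \<zeta> *\<^sub>R f \<zeta>) \<in> borel_measurable \<mu>" for n
        unfolding B_def by measurable
      show "AE \<zeta> in \<mu>. (\<lambda>n. indicat_real (B n) \<zeta> *\<^sub>R f \<zeta>) \<longlonglongrightarrow> indicat_real (box u v) \<zeta> *\<^sub>R f \<zeta>"
      proof (rule AE_I2, rule tendsto_eventually)
        fix \<zeta>
        show "\<forall>\<^sub>F n in sequentially. indicat_real (B n) \<zeta> *\<^sub>R f \<zeta> = indicat_real (box u v) \<zeta> *\<^sub>R f \<zeta>"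
          using ind[of \<zeta>] by eventually_elim simp
      qed
    qed (use f in \<open>auto simp: indicator_def\<close>)
    then show ?thesis by (simp add: zero LIMSEQ_const_iff)
  qed
  then show ?thesis
    by (rule AE_eq_0_of_box_integrals[OF \<sigma>_finite assms(2) f])
qed

end
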